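(* Let $K$ be a number field and suppose $\beta\in K$ is not $0$ or a root of unity. Then there is a constant $B$ such that for every integer $n\ge 1$ the number of Galois orbits for $z^n-\beta$ is at most $B$; that is, the number of Galois orbits for $z^n-\beta$ is bounded by a constant independent of $n$.
   Context: The Galois orbits for $z^n-\beta$ are the orbits of $\mathrm{Gal}(\overline{K}/K)$ acting on the set of roots of $z^n-\beta$ in $\overline{K}$. *)

theory Defs
  imports "HOL-Algebra.Algebraic_Closure_Type" "HOL-Algebra.Group_Action"
begin

text \<open>
  A number field is a type of class \<open>field_char_0\<close> whose elements form a
  finite-dimensional vector space over the rationals.
\<close>

definition number_field :: "'a::field_char_0 itself \<Rightarrow> bool" where
  "number_field _ \<longleftrightarrow>
     (\<exists>B. finite_dimensional_vector_space (\<lambda>(q::rat) (x::'a). of_rat q * x) B)"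

definition root_of_unity :: "'a::field \<Rightarrow> bool" where
  "root_of_unity x \<longleftrightarrow> (\<exists>m>0. x ^ m = 1)"

text \<open>
  The absolute Galois group: field automorphisms of the algebraic closure fixing the
  base field pointwise. Preservation of \<open>1\<close> is a consequence of the last condition.
\<close>

definition absolute_galois_group ::
    "('a::field alg_closure \<Rightarrow> 'a alg_closure) monoid" where
  "absolute_galois_group =
     \<lparr>carrier = {\<sigma>. bij \<sigma> \<and> (\<forall>x y. \<sigma> (x + y) = \<sigma> x + \<sigma> y) \<and>
                     (\<forall>x y. \<sigma> (x * y) = \<sigma> x * \<sigma> y) \<and>
                     (\<forall>a. \<sigma> (to_ac a) = to_ac a)},
      monoid.mult = (\<circ>), one = id\<rparr>"

definition binomial_roots :: "nat \<Rightarrow> 'a::field \<Rightarrow> 'a alg_closure set" where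
  "binomial_roots n b = {z. z ^ n - to_ac b = 0}"

definition galois_orbits :: "nat \<Rightarrow> 'a::field \<Rightarrow> 'a alg_closure set set" where
  "galois_orbits n b = orbits absolute_galois_group (binomial_roots n b) (\<lambda>\<sigma>. \<sigma>)"

lemma group_absolute_galois_group: "group (absolute_galois_group :: ('a::field alg_closure \<Rightarrow> _) monoid)"
proof (rule groupI, goal_cases)
  case (5 \<sigma>)
  then have b: "bij \<sigma>" and add: "\<And>x y. \<sigma> (x + y) = \<sigma> x + \<sigma> y"
    and mult: "\<And>x y. \<sigma> (x * y) = \<sigma> x * \<sigma> y" and fixed: "\<And>a. \<sigma> (to_ac a) = to_ac a"
    by (auto simp: absolute_galois_group_def)
  have inv_eq: "\<sigma> (inv_into UNIV \<sigma> x) = x" "inv_into UNIV \<sigma> (\<sigma> x) = x" for x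
    using b by (simp_all add: bij_is_surj surj_f_inv_f bij_is_inj)
  have "inv_into UNIV \<sigma> (x + y) = inv_into UNIV \<sigma> x + inv_into UNIV \<sigma> y" "inv_into UNIV \<sigma> (x * y) = inv_into UNIV \<sigma> x * inv_into UNIV \<sigma> y" for x y
    by (metis inv_eq add) (metis inv_eq mult)
  moreover have "inv_into UNIV \<sigma> (to_ac a) = to_ac a" for a
    by (metis inv_eq(2) fixed)
  ultimately have "inv_into UNIV \<sigma> \<in> carrier absolute_galois_group"
    using b by (simp add: absolute_galois_group_def bij_imp_bij_inv)
  moreover have "inv_into UNIV \<sigma> \<circ> \<sigma> = id"
    by (simp add: fun_eq_iff inv_eq)
  ultimately show ?case
    by (auto simp: absolute_galois_group_def)
qed (auto simp: absolute_galois_group_def bij_comp comp_assoc)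

text \<open>
  The library's group actions are by elements of \<open>Bij E\<close>, which are undefined outside \<open>E\<close>;
  restricting to \<open>E\<close> does not change the orbits.
\<close>

lemma absolute_galois_group_power:
  assumes "\<sigma> \<in> carrier absolute_galois_group"
  shows "\<sigma> (z ^ n) = \<sigma> z ^ n"
proof (induction n)
  case 0
  have "\<sigma> (to_ac 1) = to_ac 1"
    using assms unfolding absolute_galois_group_def by (simp del: to_ac_1)
  then show ?case by simp
next
  case (Suc n)
  then show ?case using assms by (simp add: absolute_galois_group_def)
qed

lemma absolute_galois_group_binomial_roots_iff:
  assumes "\<sigma> \<in> carrier absolute_galois_group"
  shows "\<sigma> z \<in> binomial_roots n b \<longleftrightarrow> z \<in> binomial_roots n b"
proof -
  have inj: "inj \<sigma>"
    using assms by (simp add: absolute_galois_group_def bij_is_inj)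
  have "\<sigma> z ^ n = to_ac b \<longleftrightarrow> \<sigma> (z ^ n) = \<sigma> (to_ac b)"
    using assms absolute_galois_group_power[OF assms] by (simp add: absolute_galois_group_def)
  also have "\<dots> \<longleftrightarrow> z ^ n = to_ac b"
    by (rule inj_eq[OF inj])
  finally show ?thesis
    by (simp add: binomial_roots_def)
qed

lemma group_action_binomial_roots:
  "group_action absolute_galois_group (binomial_roots n b)
     (\<lambda>\<sigma>. restrict \<sigma> (binomial_roots n b))"
proof -
  let ?E = "binomial_roots n b"
  let ?G = "absolute_galois_group :: ('a alg_closure \<Rightarrow> _) monoid"
  have Bij: "restrict \<sigma> ?E \<in> Bij ?E" if s: "\<sigma> \<in> carrier ?G" for \<sigma>
  proof -
    have b: "bij \<sigma>"
      using s by (simp add: absolute_galois_group_def)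
    have "inj_on \<sigma> ?E"
      using b by (meson bij_is_inj inj_on_subset subset_UNIV)
    moreover have "\<sigma> ` ?E = ?E"
    proof
      show "\<sigma> ` ?E \<subseteq> ?E"
        using absolute_galois_group_binomial_roots_iff[OF s] by auto
      show "?E \<subseteq> \<sigma> ` ?E"
      proof
        fix y assume y: "y \<in> ?E"
        obtain x where "y = \<sigma> x"
          using b by (meson bij_is_surj surjD)
        then show "y \<in> \<sigma> ` ?E"
          using y absolute_galois_group_binomial_roots_iff[OF s] by auto
      qed
    qed
    ultimately have "bij_betw \<sigma> ?E ?E"
      by (simp add: bij_betw_def)
    then show ?thesis
      by (simp add: Bij_def cong: bij_betw_cong)
  qed
  have "(\<lambda>\<sigma>. restrict \<sigma> ?E) \<in> hom ?G (BijGroup ?E)"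
  proof (rule homI)
    fix \<sigma> \<tau> assume s: "\<sigma> \<in> carrier ?G" and t: "\<tau> \<in> carrier ?G"
    show "restrict (\<sigma> \<otimes>\<^bsub>?G\<^esub> \<tau>) ?E = restrict \<sigma> ?E \<otimes>\<^bsub>BijGroup ?E\<^esub> restrict \<tau> ?E"
      using Bij[OF s] Bij[OF t] absolute_galois_group_binomial_roots_iff[OF t]
      by (auto simp: BijGroup_def compose_def absolute_galois_group_def fun_eq_iff)
  qed (use Bij in \<open>simp add: BijGroup_def\<close>)
  then show ?thesis
    by (simp add: group_action_def group_hom_def group_hom_axioms_def
        group_absolute_galois_group group_BijGroup)
qed

lemma galois_orbits_conv_restrict:
  "galois_orbits n b =
     orbits absolute_galois_group (binomial_roots n b) (\<lambda>\<sigma>. restrict \<sigma> (binomial_roots n b))"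
  by (auto simp: galois_orbits_def orbits_def orbit_def)

text \<open>In particular, \<open>card\<close> of the set of orbits is meaningful for \<open>n \<ge> 1\<close>.\<close>

lemma finite_galois_orbits:
  assumes "n \<ge> 1"
  shows "finite (galois_orbits n b)"
proof -
  let ?p = "Polynomial.monom 1 n - [:to_ac b:]"
  have "coeff ?p n = 1"
    using assms by (cases n) auto
  then have "?p \<noteq> 0"
    by (metis coeff_0 zero_neq_one)
  then have "finite {z. poly ?p z = 0}"
    by (rule poly_roots_finite)
  also have "{z. poly ?p z = 0} = binomial_roots n b"
    by (simp add: binomial_roots_def poly_monom)
  finally have "finite (binomial_roots n b)" .
  then show ?thesis
    by (simp add: galois_orbits_def orbits_def setcompr_eq_image)
qed

end

theory Submission
  imports Defs "Jordan_Normal_Form.Char_Poly"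
begin

text \<open>
  Let \<open>d\<close> be the size of an orbit. The product \<open>w\<close> of the orbit is Galois invariant, hence lies in
  \<open>K\<close>, and \<open>w^n = \<beta>^d\<close>. Combining \<open>w\<close> and \<open>\<beta>\<close> by Bezout gives \<open>\<gamma>\<close> in \<open>K\<close> with \<open>\<gamma>^n = \<beta>^gcd(n,d)\<close>:
  up to a root of unity, \<open>\<beta>\<close> is a \<open>k\<close>-th power in \<open>K\<close> for \<open>k = n / gcd(n,d)\<close>. Such \<open>\<gamma>\<close> have a common
  denominator and bounded conjugates, so there are finitely many of them (Northcott). As \<open>\<beta>\<close> is not
  a root of unity, \<open>\<gamma>\<close> determines \<open>k\<close>, so \<open>k\<close> is at most some constant \<open>B\<close>. Thus every
  orbit has at least \<open>n / B\<close> elements, and there are at most \<open>B\<close> orbits.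
\<close>

subsection \<open>The fixed field of the absolute Galois group\<close>

text \<open>
  \<open>R\<close> is the graph of a homomorphism over the base field, defined on a subring of the algebraic
  closure. Since everything is algebraic over the base field, that subring is automatically a field
  and the homomorphism is injective.
\<close>

definition partial_hom :: "('a::field alg_closure \<times> 'a alg_closure) set \<Rightarrow> bool" where
  "partial_hom R \<longleftrightarrow>
     (\<forall>a. (to_ac a, to_ac a) \<in> R) \<and>
     (\<forall>x x' y y'. (x, x') \<in> R \<longrightarrow> (y, y') \<in> R \<longrightarrow> (x + y, x' + y') \<in> R \<and> (x * y, x' * y') \<in> R) \<and>
     (\<forall>y. (0, y) \<in> R \<longrightarrow> y = 0)"

text \<open>A relation between polynomials replaces a map on coefficients, so no function has to be
  extracted from \<open>R\<close>.\<close>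

definition coeffs_in :: "('a::field alg_closure \<times> 'a alg_closure) set \<Rightarrow>
    'a alg_closure poly \<Rightarrow> 'a alg_closure poly \<Rightarrow> bool" where
  "coeffs_in R g h \<longleftrightarrow> (\<forall>i. (coeff g i, coeff h i) \<in> R)"

text \<open>The candidate graph of the extension of \<open>R\<close> that sends \<open>t\<close> to
  \<open>s\<close>. It is single-valued when \<open>s\<close> is a root of the image of a minimal
  polynomial of \<open>t\<close>.\<close>

definition adjoin :: "('a::field alg_closure \<times> 'a alg_closure) set \<Rightarrow>
    'a alg_closure \<Rightarrow> 'a alg_closure \<Rightarrow> ('a alg_closure \<times> 'a alg_closure) set" where
  "adjoin R t s = {(poly g t, poly h s) | g h. coeffs_in R g h}"

text \<open>
  \<open>p\<close> is a minimal polynomial of \<open>t\<close> over the domain of \<open>R\<close>, not necessarily monic, and \<open>r\<close> is its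
  image under \<open>R\<close>.
\<close>

definition minimal_at :: "('a::field alg_closure \<times> 'a alg_closure) set \<Rightarrow> 'a alg_closure \<Rightarrow>
    'a alg_closure poly \<Rightarrow> 'a alg_closure poly \<Rightarrow> bool" where
  "minimal_at R t p r \<longleftrightarrow> coeffs_in R p r \<and> p \<noteq> 0 \<and> poly p t = 0 \<and>
     (\<forall>g h. coeffs_in R g h \<longrightarrow> g \<noteq> 0 \<longrightarrow> poly g t = 0 \<longrightarrow> degree p \<le> degree g)"

context
  fixes R :: "('a::field alg_closure \<times> 'a alg_closure) set"
  assumes R: "partial_hom R"
begin

lemma partial_hom_base: "(to_ac a, to_ac a) \<in> R"
  and partial_hom_add: "(x, x') \<in> R \<Longrightarrow> (y, y') \<in> R \<Longrightarrow> (x + y, x' + y') \<in> R"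
  and partial_hom_mult: "(x, x') \<in> R \<Longrightarrow> (y, y') \<in> R \<Longrightarrow> (x * y, x' * y') \<in> R"
  and partial_hom_zero: "(0, y) \<in> R \<Longrightarrow> y = 0"
  using R unfolding partial_hom_def by blast+

lemma partial_hom_0: "(0, 0) \<in> R"
  and partial_hom_1: "(1, 1) \<in> R"
  using partial_hom_base[of 0] partial_hom_base[of 1] by simp_all

lemma partial_hom_minus:
  assumes "(x, x') \<in> R"
  shows "(- x, - x') \<in> R"
  using partial_hom_mult[OF partial_hom_base[of "- 1"] assms] by simp

lemma partial_hom_diff:
  assumes "(x, x') \<in> R" "(y, y') \<in> R"
  shows "(x - y, x' - y') \<in> R"
  using partial_hom_add[OF assms(1) partial_hom_minus[OF assms(2)]] by simp

lemma partial_hom_unique: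
  assumes "(x, y) \<in> R" "(x, y') \<in> R"
  shows "y = y'"
  using partial_hom_zero[of "y - y'"] partial_hom_diff[OF assms] by simp

lemma partial_hom_sum:
  "(\<And>i. i \<in> A \<Longrightarrow> (f i, g i) \<in> R) \<Longrightarrow> (sum f A, sum g A) \<in> R"
  by (induction A rule: infinite_finite_induct) (auto intro: partial_hom_0 partial_hom_add)

lemma partial_hom_poly:
  assumes "(x, y) \<in> R"
  shows "(poly (map_poly to_ac q) x, poly (map_poly to_ac q) y) \<in> R"
  using assms
  by (induction q) (auto simp: map_poly_pCons intro!: partial_hom_0 partial_hom_add
      partial_hom_mult partial_hom_base)

end

text \<open>If \<open>a + u * p(u) = 0\<close> with \<open>a\<close> nonzero, then
  \<open>- p(u) / a\<close> is the inverse of \<open>u\<close>; if \<open>a = 0\<close>, the factor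
  \<open>u\<close> cancels and the degree drops. Hence a subring containing the base field is closed
  under inverses.\<close>

lemma alg_closure_inverse_poly:
  fixes u :: "'a::field alg_closure"
  assumes "u \<noteq> 0"
  obtains q :: "'a poly" where "inverse u = poly (map_poly to_ac q) u"
proof -
  have "\<exists>q :: 'a poly. u * poly (map_poly to_ac q) u = 1"
    if "p \<noteq> 0" "poly (map_poly to_ac p) u = 0" for p :: "'a poly"
    using that
  proof (induction p)
    case (pCons a p)
    show ?case
    proof (cases "a = 0")
      case True
      then show ?thesis using pCons assms by (auto simp: map_poly_pCons)
    next
      case False
      have "map_poly to_ac (smult (- inverse a) p) = smult (- to_ac (inverse a)) (map_poly to_ac p)"
        by (rule poly_eqI) (simp add: coeff_map_poly)
      then have "u * poly (map_poly to_ac (smult (- inverse a) p)) u =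
          - inverse (to_ac a) * (u * poly (map_poly to_ac p) u)"
        by simp
      also have "u * poly (map_poly to_ac p) u = - to_ac a"
        using pCons.prems by (simp add: map_poly_pCons add_eq_0_iff)
      finally show ?thesis using False by (intro exI) auto
    qed
  qed simp
  then show ?thesis
    using alg_closure_algebraic[of u] that by (metis inverse_unique)
qed

text \<open>The inverse of a nonzero \<open>x\<close> is a base polynomial in \<open>x\<close>, so
  it lies in the domain and its image inverts the image of \<open>x\<close>, which therefore cannot
  be \<open>0\<close>.\<close>

lemma partial_hom_zero_left:
  assumes R: "partial_hom R" and "(x, 0) \<in> R"
  shows "x = 0"
proof (rule ccontr)
  assume "x \<noteq> 0"
  then obtain q where q: "inverse x = poly (map_poly to_ac q) x"
    by (rule alg_closure_inverse_poly)
  have "(x * poly (map_poly to_ac q) x, 0 * poly (map_poly to_ac q) 0) \<in> R"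
    by (intro partial_hom_mult[OF R] partial_hom_poly[OF R] assms)
  then have "(1, 0) \<in> R"
    using \<open>x \<noteq> 0\<close> by (simp flip: q)
  then show False
    using partial_hom_unique[OF R partial_hom_1[OF R]] by force
qed

lemma partial_hom_inverse:
  assumes R: "partial_hom R" and xy: "(x, y) \<in> R"
  shows "(inverse x, inverse y) \<in> R"
proof (cases "x = 0")
  case True
  then have "y = 0" using assms partial_hom_zero[OF R] by simp
  then show ?thesis using True partial_hom_0[OF R] by simp
next
  case False
  then obtain q where q: "inverse x = poly (map_poly to_ac q) x"
    by (rule alg_closure_inverse_poly)
  have "(x * inverse x, y * poly (map_poly to_ac q) y) \<in> R"
    unfolding q by (intro partial_hom_mult[OF R] partial_hom_poly[OF R] assms)
  then have "y * poly (map_poly to_ac q) y = 1"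
    using False partial_hom_unique[OF R partial_hom_1[OF R]] by force
  then have "inverse y = poly (map_poly to_ac q) y"
    by (rule inverse_unique)
  then show ?thesis
    using partial_hom_poly[OF R xy, of q] q by simp
qed

section \<open>Minimal polynomials and adjoining one element\<close>

lemma coeffs_in_const:
  assumes "partial_hom R" "(x, y) \<in> R"
  shows "coeffs_in R [:x:] [:y:]"
  using assms by (auto simp: coeffs_in_def coeff_pCons partial_hom_0 split: nat.split)

lemma coeffs_in_add:
  assumes "partial_hom R" "coeffs_in R g h" "coeffs_in R g' h'"
  shows "coeffs_in R (g + g') (h + h')"
  using assms by (simp add: coeffs_in_def partial_hom_add)

lemma coeffs_in_diff:
  assumes "partial_hom R" "coeffs_in R g h" "coeffs_in R g' h'"
  shows "coeffs_in R (g - g') (h - h')"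
  using assms by (simp add: coeffs_in_def partial_hom_diff)

lemma coeffs_in_mult:
  assumes "partial_hom R" "coeffs_in R g h" "coeffs_in R g' h'"
  shows "coeffs_in R (g * g') (h * h')"
  using assms by (simp add: coeffs_in_def coeff_mult partial_hom_mult partial_hom_sum)

lemma coeffs_in_monom:
  assumes "partial_hom R" "(x, y) \<in> R"
  shows "coeffs_in R (Polynomial.monom x n) (Polynomial.monom y n)"
  using assms by (simp add: coeffs_in_def partial_hom_0)

lemma coeffs_in_map_poly:
  assumes "partial_hom R"
  shows "coeffs_in R (map_poly to_ac q) (map_poly to_ac q)"
  using assms by (simp add: coeffs_in_def coeff_map_poly partial_hom_base)

lemma minimal_at_exists:
  assumes "partial_hom R"
  obtains p r where "minimal_at R t p r"
proof -
  obtain q :: "'a poly" where q: "q \<noteq> 0" "poly (map_poly to_ac q) t = 0"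
    by (rule alg_closure_algebraic)
  let ?P = "\<lambda>gh. coeffs_in R (fst gh) (snd gh) \<and> fst gh \<noteq> 0 \<and> poly (fst gh) t = 0"
  have "map_poly to_ac q \<noteq> 0"
    using q
    by (metis (no_types, lifting) coeff_0 coeff_map_poly leading_coeff_neq_0 to_ac_0 to_ac_eq_0_iff)
  then have "?P (map_poly to_ac q, map_poly to_ac q)"
    using q coeffs_in_map_poly[OF assms] by simp
  then obtain pr where "?P pr" "\<And>gh. ?P gh \<Longrightarrow> degree (fst pr) \<le> degree (fst gh)"
    using ex_has_least_nat[of ?P _ "\<lambda>gh. degree (fst gh)"] by blast
  then show ?thesis
    by (intro that[of "fst pr" "snd pr"]) (auto simp: minimal_at_def)
qed

text \<open>This makes the value of the extension at \<open>g(t)\<close> independent of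
  \<open>g\<close>. Division by \<open>p\<close> with the parallel operation on the images: a
  multiple of \<open>p\<close> is subtracted from \<open>g\<close>, the corresponding multiple of
  \<open>r\<close> from \<open>h\<close>, and the degree of \<open>g\<close> falls.\<close>

lemma minimal_at_kills:
  assumes R: "partial_hom R" and p: "minimal_at R t p r" and s: "poly r s = 0"
    and gh: "coeffs_in R g h" and gt: "poly g t = 0"
  shows "poly h s = 0"
  using gh gt
proof (induction "degree g" arbitrary: g h rule: less_induct)
  case less
  show ?case
  proof (cases "g = 0")
    case True
    then have "h = 0"
      using less.prems partial_hom_zero[OF R] by (auto simp: coeffs_in_def poly_eq_iff)
    then show ?thesis by simp
  next
    case False
    have deg: "degree p \<le> degree g"
      using p False less.prems by (auto simp: minimal_at_def)
    \<comment> \<open>A nonzero constant has no root. Positive degree is what lets a vanishing top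
      coefficient force a strictly smaller degree, even if the difference is
      \<open>0\<close>.\<close>
    have pos: "degree g \<noteq> 0"
      using False less.prems by (metis degree_0_id poly_const_conv[of "coeff g 0" t 0] pCons_0_0)
    \<comment> \<open>\<open>c'\<close> is the image of \<open>c\<close>. Coefficients of
      \<open>h\<close> and \<open>r\<close> are read at the degrees of \<open>g\<close> and
      \<open>p\<close>, since the relation pairs coefficients by index.\<close>
    define c c' where "c = lead_coeff g * inverse (lead_coeff p)"
      and "c' = coeff h (degree g) * inverse (coeff r (degree p))"
    define m m' where "m = Polynomial.monom c (degree g - degree p)"
      and "m' = Polynomial.monom c' (degree g - degree p)"
    have cR: "(c, c') \<in> R"
      unfolding c_def c'_def using p less.prems
      by (intro partial_hom_mult[OF R] partial_hom_inverse[OF R]) (auto simp: coeffs_in_def minimal_at_def)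
    have in_R: "coeffs_in R (g - m * p) (h - m' * r)"
      unfolding m_def m'_def using p less.prems cR
      by (intro coeffs_in_diff[OF R] coeffs_in_mult[OF R] coeffs_in_monom[OF R])
         (auto simp: minimal_at_def)
    have p0: "p \<noteq> 0" "poly p t = 0" using p by (auto simp: minimal_at_def)
    have "degree (m * p) \<le> degree g"
      unfolding m_def using degree_mult_le[of "Polynomial.monom c (degree g - degree p)" p]
        degree_monom_le[of c "degree g - degree p"] deg by linarith
    then have "degree (g - m * p) \<le> degree g"
      by (simp add: degree_diff_le)
    moreover have "coeff (m * p) (degree g) = lead_coeff g"
      using p0 deg unfolding m_def by (simp add: coeff_monom_mult c_def)
    then have "coeff (g - m * p) (degree g) = 0" by simp
    ultimately have "degree (g - m * p) < degree g"
      using eq_zero_or_degree_less pos by fastforce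
    then have "poly (h - m' * r) s = 0"
      by (rule less.hyps[OF _ in_R]) (use less.prems p0 in simp)
    then show ?thesis using s by simp
  qed
qed

lemma adjoin_contains:
  assumes R: "partial_hom R"
  shows "R \<subseteq> adjoin R t s" and "(t, s) \<in> adjoin R t s"
proof
  fix xy assume "xy \<in> R"
  then have "coeffs_in R [:fst xy:] [:snd xy:]"
    by (intro coeffs_in_const[OF R]) simp
  then show "xy \<in> adjoin R t s"
    unfolding adjoin_def by (intro CollectI exI[of _ "[:fst xy:]"] exI[of _ "[:snd xy:]"]) simp
next
  have "coeffs_in R (Polynomial.monom 1 1) (Polynomial.monom 1 1)"
    by (intro coeffs_in_monom[OF R] partial_hom_1[OF R])
  then show "(t, s) \<in> adjoin R t s"
    unfolding adjoin_def
    by (auto simp: poly_monom intro!: exI[of _ "Polynomial.monom 1 1"])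
qed

lemma partial_hom_adjoin:
  assumes R: "partial_hom R" and p: "minimal_at R t p r" and s: "poly r s = 0"
  shows "partial_hom (adjoin R t s)"
  unfolding partial_hom_def
proof (intro conjI allI impI)
  fix a show "(to_ac a, to_ac a) \<in> adjoin R t s"
    using adjoin_contains(1)[OF R] partial_hom_base[OF R] by blast
next
  fix y assume "(0, y) \<in> adjoin R t s"
  then obtain g h where gh: "coeffs_in R g h" "poly g t = 0" "y = poly h s"
    unfolding adjoin_def by auto
  then show "y = 0"
    using minimal_at_kills[OF R p s] by simp
next
  fix x x' y y' assume "(x, x') \<in> adjoin R t s" "(y, y') \<in> adjoin R t s"
  then obtain g h g' h' where "coeffs_in R g h" "coeffs_in R g' h'"
    "x = poly g t" "x' = poly h s" "y = poly g' t" "y' = poly h' s"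
    unfolding adjoin_def by auto
  then show "(x + y, x' + y') \<in> adjoin R t s" "(x * y, x' * y') \<in> adjoin R t s"
    unfolding adjoin_def using coeffs_in_add[OF R] coeffs_in_mult[OF R] poly_add poly_mult
    by (smt (verit) mem_Collect_eq)+
qed

section \<open>Extension to automorphisms\<close>

text \<open>Zorn's lemma gives a maximal graph \<open>M\<close>. It is total because any
  \<open>t\<close> can be adjoined, and the resulting endomorphism is injective; algebraicity makes
  it surjective.\<close>

lemma partial_hom_extends:
  assumes R: "partial_hom R"
  obtains \<sigma> where "\<sigma> \<in> carrier absolute_galois_group" "\<And>x y. (x, y) \<in> R \<Longrightarrow> \<sigma> x = y"
proof -
  define \<A> where "\<A> = {S. partial_hom S \<and> R \<subseteq> S}"
  have "\<exists>M\<in>\<A>. \<forall>S\<in>\<A>. M \<subseteq> S \<longrightarrow> S = M"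
  proof (rule subset_Zorn_nonempty)
    show "\<A> \<noteq> {}" using R by (auto simp: \<A>_def)
  next
    fix \<C> assume ne: "\<C> \<noteq> {}" and ch: "subset.chain \<A> \<C>"
    have ph: "partial_hom S" and RS: "R \<subseteq> S" if "S \<in> \<C>" for S
      using ch that by (auto simp: subset_chain_def \<A>_def)
    have lin: "S \<subseteq> T \<or> T \<subseteq> S" if "S \<in> \<C>" "T \<in> \<C>" for S T
      using ch that by (auto simp: subset_chain_def)
    obtain S\<^sub>0 where S\<^sub>0: "S\<^sub>0 \<in> \<C>" using ne by blast
    have "partial_hom (\<Union>\<C>)"
      unfolding partial_hom_def
    proof (intro conjI allI impI)
      fix a show "(to_ac a, to_ac a) \<in> \<Union>\<C>"
        using partial_hom_base[OF ph[OF S\<^sub>0]] S\<^sub>0 by (rule UnionI[rotated])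
    next
      fix y assume "(0, y) \<in> \<Union>\<C>"
      then obtain S where "S \<in> \<C>" "(0, y) \<in> S" by (elim UnionE)
      then show "y = 0" using partial_hom_zero[OF ph] by simp
    next
      fix x x' y y' assume "(x, x') \<in> \<Union>\<C>" "(y, y') \<in> \<Union>\<C>"
      then obtain S T where "S \<in> \<C>" "(x, x') \<in> S" "T \<in> \<C>" "(y, y') \<in> T"
        by (elim UnionE)
      then obtain U where U: "U \<in> \<C>" "(x, x') \<in> U" "(y, y') \<in> U"
        using lin[of S T] by auto
      show "(x + y, x' + y') \<in> \<Union>\<C>" "(x * y, x' * y') \<in> \<Union>\<C>"
        using partial_hom_add[OF ph[OF U(1)] U(2,3)] partial_hom_mult[OF ph[OF U(1)] U(2,3)] U(1)
        by blast+
    qed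
    moreover have "R \<subseteq> \<Union>\<C>"
      using RS[OF S\<^sub>0] S\<^sub>0 by (rule order.trans[OF _ Union_upper])
    ultimately show "\<Union>\<C> \<in> \<A>" by (simp add: \<A>_def)
  qed
  then obtain M where "M \<in> \<A>" and M_max: "\<And>S. S \<in> \<A> \<Longrightarrow> M \<subseteq> S \<Longrightarrow> S = M"
    by blast
  then have M: "partial_hom M" "R \<subseteq> M"
    by (simp_all add: \<A>_def)
  have max: "S = M" if "partial_hom S" "M \<subseteq> S" for S
    by (rule M_max) (use that M in \<open>simp_all add: \<A>_def\<close>)
  have total: "\<exists>s. (t, s) \<in> M" for t
  proof -
    obtain p r where p: "minimal_at M t p r"
      using minimal_at_exists[OF M(1)] by blast
    have "degree p \<noteq> 0"
    proof
      assume "degree p = 0"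
      then obtain c where "p = [:c:]" by (rule degree_eq_zeroE)
      then show False using p by (simp add: minimal_at_def)
    qed
    \<comment> \<open>Injectivity keeps the image of the leading coefficient nonzero, so
      \<open>r\<close> is nonconstant and has a root to which \<open>t\<close> can be sent.\<close>
    moreover have "(lead_coeff p, coeff r (degree p)) \<in> M" "lead_coeff p \<noteq> 0"
      using p by (auto simp: minimal_at_def coeffs_in_def)
    then have "coeff r (degree p) \<noteq> 0"
      using partial_hom_zero_left[OF M(1)] by metis
    then have "degree p \<le> degree r" by (rule le_degree)
    ultimately obtain s where s: "poly r s = 0"
      using alg_closed_imp_poly_has_root[of r] by auto
    have "adjoin M t s = M"
      using partial_hom_adjoin[OF M(1) p s] adjoin_contains(1)[OF M(1)] by (rule max)
    then show ?thesis using adjoin_contains(2)[OF M(1)] by metis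
  qed
  define \<sigma> where "\<sigma> t = (SOME s. (t, s) \<in> M)" for t
  have \<sigma>: "(t, \<sigma> t) \<in> M" for t
    unfolding \<sigma>_def using total by (rule someI_ex)
  have eq: "\<sigma> x = y" if "(x, y) \<in> M" for x y
    using partial_hom_unique[OF M(1) \<sigma> that] .
  have add: "\<sigma> (x + y) = \<sigma> x + \<sigma> y" and mult: "\<sigma> (x * y) = \<sigma> x * \<sigma> y"
    and base: "\<sigma> (to_ac a) = to_ac a" for x y a
    using \<sigma> by (auto intro!: eq partial_hom_add partial_hom_mult partial_hom_base M)
  have inj: "inj \<sigma>"
  proof (rule injI)
    fix x y assume "\<sigma> x = \<sigma> y"
    then have "(x - y, 0) \<in> M"
      using partial_hom_diff[OF M(1) \<sigma> \<sigma>, of x y] by simp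
    then show "x = y" using partial_hom_zero_left[OF M(1)] by fastforce
  qed
  \<comment> \<open>\<open>y\<close> is a root of a polynomial over the base field. Its finite root
    set is mapped injectively into itself, hence onto itself.\<close>
  have "\<exists>x. \<sigma> x = y" for y
  proof -
    obtain q :: "'a poly" where q: "q \<noteq> 0" "poly (map_poly to_ac q) y = 0"
      by (rule alg_closure_algebraic)
    let ?Z = "{z. poly (map_poly to_ac q) z = 0}"
    have "map_poly to_ac q \<noteq> 0"
      using q
      by (metis (no_types, lifting) coeff_0 coeff_map_poly leading_coeff_neq_0 to_ac_0 to_ac_eq_0_iff)
    then have "finite ?Z" by (rule poly_roots_finite)
    moreover have "\<sigma> ` ?Z \<subseteq> ?Z"
    proof
      fix u assume "u \<in> \<sigma> ` ?Z"
      then obtain z where z: "poly (map_poly to_ac q) z = 0" "u = \<sigma> z" by auto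
      have "(0, poly (map_poly to_ac q) u) \<in> M"
        using partial_hom_poly[OF M(1) \<sigma>, of q z] z by simp
      then show "u \<in> ?Z" using partial_hom_zero[OF M(1)] by simp
    qed
    ultimately have "\<sigma> ` ?Z = ?Z"
      using inj_on_subset[OF inj subset_UNIV] by (rule endo_inj_surj)
    moreover have "y \<in> ?Z" using q by simp
    ultimately have "y \<in> \<sigma> ` ?Z" by blast
    then show ?thesis by auto
  qed
  then have "surj \<sigma>" unfolding surj_def by metis
  then have "bij \<sigma>" using inj by (simp add: bij_def)
  then have "\<sigma> \<in> carrier absolute_galois_group"
    using add mult base by (simp add: absolute_galois_group_def)
  then show ?thesis
    using eq M(2) by (intro that[of \<sigma>]) auto
qed

lemma partial_hom_diagonal: "partial_hom (range (\<lambda>a. (to_ac a, to_ac a)))"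
  unfolding partial_hom_def by (auto simp flip: to_ac_add to_ac_mult)

text \<open>If the minimal polynomial of \<open>w\<close> over the base field is not linear, it has
  a second root \<open>s\<close>, and sending \<open>w\<close> to \<open>s\<close> extends to an
  automorphism that moves \<open>w\<close>.\<close>

theorem absolute_galois_group_fixed:
  fixes w :: "'a::field_char_0 alg_closure"
  assumes "\<And>\<sigma>. \<sigma> \<in> carrier absolute_galois_group \<Longrightarrow> \<sigma> w = w"
  shows "w \<in> range to_ac"
proof -
  let ?K = "range (\<lambda>a::'a. (to_ac a, to_ac a))"
  note K = partial_hom_diagonal
  obtain p r where p: "minimal_at ?K w p r"
    using minimal_at_exists[OF K] by blast
  \<comment> \<open>The diagonal graph is the identity on the base field, so it leaves polynomials
    unchanged.\<close>
  have r: "r = p"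
    using p by (intro poly_eqI) (metis (mono_tags, lifting) coeffs_in_def imageE minimal_at_def prod.inject)
  have coeff: "coeff p i \<in> range to_ac" for i
    using p by (fastforce simp: minimal_at_def coeffs_in_def)
  have p0: "p \<noteq> 0" "poly p w = 0"
    using p by (auto simp: minimal_at_def)
  obtain q where q: "p = [:- w, 1:] * q"
    using p0 by (metis poly_eq_0_iff_dvd dvdE)
  then have q0: "q \<noteq> 0" using p0 by auto
  have dp: "degree p = Suc (degree q)"
    using q q0 by (simp add: degree_mult_eq del: mult_pCons_left)
  show ?thesis
  proof (cases "degree q = 0")
    case True
    then obtain b where b: "q = [:b:]" by (metis degree_0_id)
    \<comment> \<open>Here \<open>p\<close> is linear but perhaps not monic; \<open>w\<close> is
      recovered as a quotient of its two coefficients.\<close>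
    have "coeff p 0 = - w * b" "coeff p 1 = b" using q b by auto
    then obtain c d where cd: "to_ac c = - w * b" "to_ac d = b"
      using coeff by (metis imageE)
    then have "to_ac (- c / d) = w" using q0 b by simp
    then show ?thesis by (metis rangeI)
  next
    case False
    then obtain s where s: "poly q s = 0"
      using alg_closed_imp_poly_has_root[of q] by auto
    \<comment> \<open>A double root would be a root of the derivative, which in characteristic
      \<open>0\<close> is a nonzero polynomial of smaller degree over the base field.\<close>
    have "s \<noteq> w"
    proof
      assume "s = w"
      then have "poly (pderiv p) w = 0"
        using s by (simp add: q pderiv_mult del: mult_pCons_left)
      moreover have "pderiv p \<noteq> 0" "degree (pderiv p) < degree p"
        using dp by (auto simp: pderiv_eq_0_iff degree_pderiv)
      moreover have "coeffs_in ?K (pderiv p) (pderiv p)"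
        unfolding coeffs_in_def
      proof
        fix i
        obtain a where "coeff p (Suc i) = to_ac a" using coeff[of "Suc i"] by (elim rangeE)
        then have "coeff (pderiv p) i = to_ac (of_nat (Suc i) * a)"
          by (simp only: coeff_pderiv to_ac_mult to_ac_of_nat)
        then show "(coeff (pderiv p) i, coeff (pderiv p) i) \<in> ?K"
          by (intro image_eqI[of _ _ "of_nat (Suc i) * a"]) (simp_all only: UNIV_I)
      qed
      ultimately show False
        using p unfolding minimal_at_def by (meson leD)
    qed
    have "poly r s = 0" using s r q by simp
    then have "partial_hom (adjoin ?K w s)"
      by (rule partial_hom_adjoin[OF K p])
    then obtain \<sigma> where "\<sigma> \<in> carrier absolute_galois_group"
      "\<And>x y. (x, y) \<in> adjoin ?K w s \<Longrightarrow> \<sigma> x = y"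
      by (rule partial_hom_extends) blast
    then have "\<sigma> \<in> carrier absolute_galois_group" "\<sigma> w = s"
      using adjoin_contains(2)[OF K] by blast+
    then show ?thesis using assms \<open>s \<noteq> w\<close> by auto
  qed
qed

subsection \<open>Northcott finiteness\<close>

text \<open>A bound on the operator norm for the maximum norm, kept in the integers. It is
  submultiplicative and controls eigenvalues.\<close>

definition row_sums_le :: "int mat \<Rightarrow> int \<Rightarrow> bool" where
  "row_sums_le A r \<longleftrightarrow> (\<forall>i<dim_row A. (\<Sum>j<dim_col A. \<bar>A $$ (i, j)\<bar>) \<le> r)"

lemma row_sums_le_mult:
  assumes A: "A \<in> carrier_mat n n" and B: "B \<in> carrier_mat n n"
    and r: "row_sums_le A r" and s: "row_sums_le B s" and s0: "s \<ge> 0"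
  shows "row_sums_le (A * B) (r * s)"
  unfolding row_sums_le_def
proof (intro allI impI)
  fix i assume "i < dim_row (A * B)"
  then have i: "i < n" using A by simp
  have "(\<Sum>j<n. \<bar>(A * B) $$ (i, j)\<bar>) \<le> (\<Sum>j<n. \<Sum>k<n. \<bar>A $$ (i, k)\<bar> * \<bar>B $$ (k, j)\<bar>)"
  proof (rule sum_mono)
    fix j assume "j \<in> {..<n}"
    then have "(A * B) $$ (i, j) = (\<Sum>k<n. A $$ (i, k) * B $$ (k, j))"
      using A B i by (auto simp: scalar_prod_def atLeast0LessThan intro!: sum.cong)
    then show "\<bar>(A * B) $$ (i, j)\<bar> \<le> (\<Sum>k<n. \<bar>A $$ (i, k)\<bar> * \<bar>B $$ (k, j)\<bar>)"
      using sum_abs[of "\<lambda>k. A $$ (i, k) * B $$ (k, j)" "{..<n}"] by (simp add: abs_mult)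
  qed
  also have "\<dots> = (\<Sum>k<n. \<bar>A $$ (i, k)\<bar> * (\<Sum>j<n. \<bar>B $$ (k, j)\<bar>))"
    by (subst sum.swap) (simp add: sum_distrib_left)
  also have "\<dots> \<le> (\<Sum>k<n. \<bar>A $$ (i, k)\<bar> * s)"
    using s B by (intro sum_mono mult_left_mono) (auto simp: row_sums_le_def)
  also have "\<dots> = (\<Sum>k<n. \<bar>A $$ (i, k)\<bar>) * s"
    by (simp add: sum_distrib_right)
  also have "\<dots> \<le> r * s"
    using r A i s0 by (intro mult_right_mono) (auto simp: row_sums_le_def)
  finally show "(\<Sum>j<dim_col (A * B). \<bar>(A * B) $$ (i, j)\<bar>) \<le> r * s"
    using B by simp
qed

lemma row_sums_le_pow:
  assumes A: "A \<in> carrier_mat n n" and r: "row_sums_le A r" and r0: "r \<ge> 0"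
  shows "row_sums_le (A ^\<^sub>m k) (r ^ k)"
proof (induction k)
  case 0
  show ?case by (auto simp: row_sums_le_def if_distrib sum.delta' cong: if_cong)
next
  case (Suc k)
  then show ?case
    using row_sums_le_mult[OF pow_carrier_mat[OF A] A Suc r r0] by (simp add: mult.commute)
qed

lemma row_sums_le_exists:
  obtains r where "row_sums_le A r" "r \<ge> 0"
proof
  define f where "f i = (\<Sum>j<dim_col A. \<bar>A $$ (i, j)\<bar>)" for i
  have "f i \<le> (\<Sum>i<dim_row A. f i)" if "i < dim_row A" for i
    using that by (intro member_le_sum) (auto simp: f_def sum_nonneg)
  then show "row_sums_le A (\<Sum>i<dim_row A. f i)"
    unfolding row_sums_le_def by (simp add: f_def)
  show "(\<Sum>i<dim_row A. f i) \<ge> 0"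
    by (auto simp: f_def intro!: sum_nonneg)
qed

text \<open>The eigenvector equation is compared at a coordinate where the eigenvector has its
  largest modulus \<open>M\<close>.\<close>

lemma eigenvalue_le_row_sums:
  assumes A: "A \<in> carrier_mat n n" and r: "row_sums_le A r"
    and ev: "eigenvalue (map_mat of_int A) (z :: complex)"
  shows "cmod z \<le> real_of_int r"
proof -
  obtain v where v: "v \<in> carrier_vec n" "v \<noteq> 0\<^sub>v n" "map_mat of_int A *\<^sub>v v = z \<cdot>\<^sub>v v"
    using ev A by (auto simp: eigenvalue_def eigenvector_def)
  then obtain i0 where i0: "i0 < n" "v $ i0 \<noteq> 0"
    by (metis carrier_vecD eq_vecI index_zero_vec(1) index_zero_vec(2))
  define M where "M = Max ((\<lambda>i. cmod (v $ i)) ` {..<n})"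
  have "M \<in> (\<lambda>i. cmod (v $ i)) ` {..<n}"
    unfolding M_def using i0 by (intro Max_in) auto
  then obtain i where i: "i < n" "M = cmod (v $ i)" by auto
  have le: "cmod (v $ j) \<le> M" if "j < n" for j
    unfolding M_def using that by (intro Max_ge) auto
  have M0: "M > 0" using le[OF i0(1)] i0(2) by (smt (verit) zero_less_norm_iff)
  have "z * v $ i = (\<Sum>j<n. of_int (A $$ (i, j)) * v $ j)"
    using arg_cong[OF v(3), of "\<lambda>w :: _ vec. w $ i"] v(1) A i
    by (simp add: scalar_prod_def atLeast0LessThan)
  then have "cmod z * M = cmod (\<Sum>j<n. of_int (A $$ (i, j)) * v $ j)"
    using i by (metis norm_mult)
  also have "\<dots> \<le> (\<Sum>j<n. real_of_int \<bar>A $$ (i, j)\<bar> * M)"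
    using le by (intro order.trans[OF norm_sum] sum_mono) (simp add: norm_mult mult_left_mono)
  also have "\<dots> = real_of_int (\<Sum>j<n. \<bar>A $$ (i, j)\<bar>) * M"
    by (simp add: sum_distrib_right)
  also have "\<dots> \<le> real_of_int r * M"
    using r A i M0 by (intro mult_right_mono iffD2[OF of_int_le_iff]) (auto simp: row_sums_le_def)
  finally show ?thesis using M0 by simp
qed

lemma eigenvalue_pow_mat:
  fixes A :: "'a::field mat"
  assumes A: "A \<in> carrier_mat n n" and "eigenvalue A e"
  shows "eigenvalue (A ^\<^sub>m k) (e ^ k)"
  using assms eigenvector_pow[OF A] unfolding eigenvalue_def eigenvector_def by auto

lemma eigenvalue_smult_mat:
  fixes A :: "'a::field mat"
  assumes A: "A \<in> carrier_mat n n" and "eigenvalue A e"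
  shows "eigenvalue (c \<cdot>\<^sub>m A) (c * e)"
proof -
  obtain v where v: "v \<in> carrier_vec n" "v \<noteq> 0\<^sub>v n" "A *\<^sub>v v = e \<cdot>\<^sub>v v"
    using assms by (auto simp: eigenvalue_def eigenvector_def)
  have "(c \<cdot>\<^sub>m A) *\<^sub>v v = c \<cdot>\<^sub>v (A *\<^sub>v v)"
    using A v(1) by (intro eq_vecI) auto
  then show ?thesis
    using v A by (auto simp: eigenvalue_def eigenvector_def smult_smult_assoc intro!: exI[of _ v])
qed

text \<open>One integer polynomial describes the eigenvalues in every field of characteristic
  \<open>0\<close>, which transfers information between the number field and the complex
  numbers.\<close>

lemma eigenvalue_of_int_root:
  fixes e :: "'a::field_char_0"
  assumes "A \<in> carrier_mat n n"
  shows "eigenvalue (map_mat of_int A) e \<longleftrightarrow> poly (map_poly of_int (char_poly A)) e = 0"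
  using assms by (subst eigenvalue_root_char_poly[of _ n]) (simp_all add: of_int_hom.char_poly_hom)

text \<open>Minimality forces the pseudo-remainder to vanish, and Gauss's lemma removes the constant factor.\<close>

lemma primitive_minimal_dvd:
  fixes x :: "'a::field_char_0" and f F :: "int poly"
  assumes f: "f \<noteq> 0" "content f = 1" "poly (map_poly of_int f) x = 0"
    and min: "\<And>g :: int poly. g \<noteq> 0 \<Longrightarrow> poly (map_poly of_int g) x = 0 \<Longrightarrow> degree f \<le> degree g"
    and F: "poly (map_poly of_int F) x = 0"
  shows "f dvd F"
proof -
  define c where "c = lead_coeff f ^ (Suc (degree F) - degree f)"
  obtain q r where qr: "pseudo_divmod F f = (q, r)" by force
  have eq: "Polynomial.smult c F = f * q + r" and r: "r = 0 \<or> degree r < degree f"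
    using pseudo_divmod[OF f(1) qr] by (simp_all add: c_def)
  have "poly (map_poly of_int (Polynomial.smult c F)) x = poly (map_poly of_int r) x"
    unfolding eq using f by (simp add: of_int_poly_hom.hom_add of_int_poly_hom.hom_mult)
  moreover have "poly (map_poly of_int (Polynomial.smult c F)) x = of_int c * poly (map_poly of_int F) x"
    by (simp add: hom_distribs)
  ultimately have "poly (map_poly of_int r) x = 0"
    using F by simp
  then have "r = 0" using r min by (meson leD)
  then have eq: "Polynomial.smult c F = f * q" using eq by simp
  \<comment> \<open>Since \<open>f\<close> is primitive, comparing contents shows that
    \<open>c\<close> divides every coefficient of \<open>q\<close> and may be cancelled.\<close>
  have "content q = \<bar>c\<bar> * content F"
    using arg_cong[OF eq, of content] f by (simp add: content_mult)
  then have "[:c:] dvd q"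
    by (metis abs_dvd_iff const_poly_dvd_iff_dvd_content dvd_triv_left)
  then obtain q' where "q = Polynomial.smult c q'"
    by (metis dvdE mult_pCons_left pCons_0_0 add_0_right smult_0_right mult_zero_left)
  then have "Polynomial.smult c (F - f * q') = 0"
    using eq by (simp add: smult_diff_right)
  moreover have "c \<noteq> 0" using f by (simp add: c_def)
  ultimately show ?thesis by simp
qed

section \<open>Bounded degree and bounded conjugates\<close>

lemma coeff_linear_mult_le:
  fixes p :: "complex poly"
  assumes IH: "\<And>j. cmod (coeff p j) \<le> (1 + r) ^ n" and "cmod a \<le> r" "r \<ge> 0"
  shows "cmod (coeff ([:- a, 1:] * p) i) \<le> (1+r)^Suc n"
proof -
  have "coeff ([:- a, 1:] * p) i = (if i = 0 then 0 else coeff p (i - 1)) - a * coeff p i"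
    by (cases i) (simp_all add: coeff_pCons)
  then have "cmod (coeff ([:- a, 1:] * p) i) \<le>
      (if i = 0 then 0 else cmod (coeff p (i - 1))) + cmod a * cmod (coeff p i)"
    using norm_triangle_ineq4[of "if i = 0 then 0 else coeff p (i - 1)" "a * coeff p i"]
    by (simp only: norm_mult if_distrib[of cmod] norm_zero)
  also have "\<dots> \<le> (1 + r) ^ n + r * (1 + r) ^ n"
    using assms by (intro add_mono mult_mono) (simp_all)
  finally show ?thesis by (simp add: algebra_simps)
qed

text \<open>Each further linear factor multiplies the coefficient bound by at most
  \<open>1 + r\<close>.\<close>

lemma coeff_prod_linear_le:
  fixes as :: "complex list"
  assumes "\<And>a. a \<in> set as \<Longrightarrow> cmod a \<le> r" "r \<ge> 0"
  shows "cmod (coeff (\<Prod>a\<leftarrow>as. [:- a, 1:]) i) \<le> (1 + r) ^ length as"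
  using assms(1)
proof (induction as arbitrary: i)
  case Nil
  show ?case by simp
next
  case (Cons a as)
  have "cmod (coeff (\<Prod>a\<leftarrow>as. [:- a, 1:]) j) \<le> (1 + r) ^ length as" for j
    using Cons by simp
  then show ?case
    using coeff_linear_mult_le[of "\<Prod>a\<leftarrow>as. [:- a, 1:]" r "length as" a i] Cons.prems assms(2)
    by (simp only: list.map prod_list.Cons list.size list.set_intros add_Suc_right add_0_right plus_1_eq_Suc)
qed

lemma finite_int_polys_bounded:
  "finite {f :: int poly. degree f \<le> N \<and> (\<forall>i. \<bar>coeff f i\<bar> \<le> C)}"
proof (rule finite_subset)
  show "{f :: int poly. degree f \<le> N \<and> (\<forall>i. \<bar>coeff f i\<bar> \<le> C)} \<subseteq>
      Poly ` {xs. set xs \<subseteq> {- C..C} \<and> length xs \<le> Suc N}"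
  proof
    fix f :: "int poly" assume f: "f \<in> {f. degree f \<le> N \<and> (\<forall>i. \<bar>coeff f i\<bar> \<le> C)}"
    have "set (coeffs f) \<subseteq> {- C..C}"
    proof
      fix c assume "c \<in> set (coeffs f)"
      then obtain i where "c = coeff f i"
        by (auto simp: coeffs_def split: if_splits)
      then have "\<bar>c\<bar> \<le> C" using f by simp
      then show "c \<in> {- C..C}" by (simp add: abs_le_iff)
    qed
    moreover have "length (coeffs f) \<le> Suc N"
      using f by (simp add: coeffs_def)
    ultimately show "f \<in> Poly ` {xs. set xs \<subseteq> {- C..C} \<and> length xs \<le> Suc N}"
      by (intro image_eqI[of _ _ "coeffs f"]) simp_all
  qed
  show "finite (Poly ` {xs. set xs \<subseteq> {- C..C} \<and> length xs \<le> Suc N})"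
    by (intro finite_imageI finite_lists_length_le) auto
qed

text \<open>
  The conjugates of \<open>x\<close> are among the complex roots of the monic annihilator \<open>F\<close>, whose degree need
  not be bounded.
\<close>

lemma finite_integral_bounded:
  fixes S :: "'a::field_char_0 set"
  assumes deg: "\<And>x. x \<in> S \<Longrightarrow> \<exists>g :: int poly. g \<noteq> 0 \<and> degree g \<le> N \<and> poly (map_poly of_int g) x = 0"
    and bdd: "\<And>x. x \<in> S \<Longrightarrow> \<exists>F :: int poly. lead_coeff F = 1 \<and> poly (map_poly of_int F) x = 0 \<and>
      (\<forall>z. poly (map_poly of_int F) z = 0 \<longrightarrow> cmod z \<le> r)"
  shows "finite S"
proof -
  \<comment> \<open>Now \<open>1 + r'\<close> is at least \<open>1\<close>, so its power with
    exponent the degree of \<open>f\<close> is at most its \<open>N\<close>-th power.\<close>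
  define r' where "r' = max 0 r"
  define C where "C = \<lceil>(1 + r') ^ N\<rceil>"
  let ?P = "{f :: int poly. degree f \<le> N \<and> (\<forall>i. \<bar>coeff f i\<bar> \<le> C)} - {0}"
  have "S \<subseteq> (\<Union>f\<in>?P. {x. poly (map_poly of_int f) x = 0})"
  proof
    fix x assume x: "x \<in> S"
    let ?Q = "\<lambda>g :: int poly. g \<noteq> 0 \<and> poly (map_poly of_int g) x = 0"
    obtain g0 where g0: "?Q g0" "degree g0 \<le> N" using deg[OF x] by blast
    then obtain g where g: "?Q g" and min: "\<And>h. ?Q h \<Longrightarrow> degree g \<le> degree h"
      using ex_has_least_nat[of ?Q g0 degree] by blast
    define f where "f = primitive_part g"
    have "map_poly of_int g = Polynomial.smult (of_int (content g) :: 'a) (map_poly of_int f)"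
      unfolding f_def by (metis content_times_primitive_part of_int_hom.map_poly_hom_smult)
    then have f: "f \<noteq> 0" "content f = 1" "poly (map_poly of_int f) x = 0" "degree f = degree g"
      using g by (auto simp: f_def)
    obtain F :: "int poly" where F: "lead_coeff F = 1" "poly (map_poly of_int F) x = 0"
      "\<And>z. poly (map_poly of_int F) z = 0 \<Longrightarrow> cmod z \<le> r"
      using bdd[OF x] by blast
    have "f dvd F"
      using primitive_minimal_dvd[OF f(1-3) _ F(2)] min f(4) by auto
    then obtain k where k: "F = f * k" by auto
    \<comment> \<open>The leading coefficient of \<open>f\<close> divides that of the monic
      \<open>F\<close>. So the coefficients of \<open>f\<close> are bounded through its roots alone,
      and these are roots of \<open>F\<close>.\<close>
    then have unit: "\<bar>lead_coeff f\<bar> = 1"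
      using F(1) by (metis abs_mult lead_coeff_mult abs_1 zmult_eq_1_iff abs_ge_zero zdvd1_eq dvd_triv_left)
    let ?fc = "map_poly of_int f :: complex poly"
    obtain as where as: "Polynomial.smult (lead_coeff ?fc) (\<Prod>a\<leftarrow>as. [:- a, 1:]) = ?fc" "length as = degree ?fc"
      using fundamental_theorem_algebra_factorized[of ?fc] by blast
    have fc0: "?fc \<noteq> 0" using f(1) by simp
    have root: "cmod a \<le> r'" if "a \<in> set as" for a
    proof -
      have "poly (\<Prod>a\<leftarrow>as. [:- a, 1:]) a = 0"
        using that by (induction as) auto
      then have "poly ?fc a = 0" by (metis as(1) poly_smult mult_zero_right)
      then have "poly (map_poly of_int F) a = 0"
        by (simp add: k hom_distribs)
      then show ?thesis using F(3) by (fastforce simp: r'_def)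
    qed
    have "\<bar>coeff f i\<bar> \<le> C" for i
    proof -
      have "real_of_int \<bar>coeff f i\<bar> = cmod (coeff ?fc i)" by simp
      also have "\<dots> = cmod (lead_coeff ?fc) * cmod (coeff (\<Prod>a\<leftarrow>as. [:- a, 1:]) i)"
        by (metis as(1) coeff_smult norm_mult)
      also have "cmod (lead_coeff ?fc) = 1"
        using unit by simp
      also have "1 * cmod (coeff (\<Prod>a\<leftarrow>as. [:- a, 1:]) i) \<le> (1 + r') ^ length as"
        using coeff_prod_linear_le[OF root] by (simp add: r'_def)
      also have "\<dots> \<le> (1 + r') ^ N"
        using as(2) f(4) min[OF g0(1)] g0(2) by (intro power_increasing) (auto simp: r'_def)
      finally show ?thesis unfolding C_def by linarith
    qed
    then show "x \<in> (\<Union>f\<in>?P. {x. poly (map_poly of_int f) x = 0})"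
      using f min[OF g0(1)] g0(2) by auto
  qed
  moreover have "finite (\<Union>f\<in>?P. {x :: 'a. poly (map_poly of_int f) x = 0})"
    using finite_int_polys_bounded by (intro finite_UN_I poly_roots_finite finite_Diff) auto
  ultimately show ?thesis by (rule finite_subset)
qed

text \<open>
  \<open>A\<close> is \<open>c\<close> times the matrix of multiplication by \<open>y\<close> in a rational basis; the basis vectors form
  the eigenvector.
\<close>

lemma number_field_int_matrix:
  assumes "number_field TYPE('a::field_char_0)"
  obtains N where "\<And>y :: 'a. \<exists>A c. A \<in> carrier_mat N N \<and> c > 0 \<and>
    eigenvalue (map_mat of_int A) (of_int c * y)"
proof -
  obtain Basis :: "'a set" where "finite_dimensional_vector_space (\<lambda>(q::rat) (x::'a). of_rat q * x) Basis"
    using assms unfolding number_field_def by blast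
  then interpret finite_dimensional_vector_space "\<lambda>(q::rat) (x::'a). of_rat q * x" Basis .
  obtain bs where bs: "set bs = Basis" "distinct bs"
    using finite_distinct_list[OF finite_Basis] by blast
  define N where "N = length bs"
  have "Basis \<noteq> {}"
  proof
    assume "Basis = {}"
    then have "UNIV = {0 :: 'a}" using span_Basis by simp
    then have "(1 :: 'a) \<in> {0}" using UNIV_I by (rule subst)
    then show False by simp
  qed
  then have "N > 0" using bs(1) by (auto simp: N_def)
  have bs_nz: "bs ! i \<noteq> 0" if "i < N" for i
  proof -
    have "bs ! i \<in> Basis" using that bs(1) nth_mem by (simp add: N_def flip: bs(1))
    then show ?thesis using independent_Basis dependent_zero by metis
  qed
  have span: "\<exists>u. x = (\<Sum>j<N. of_rat (u j) * bs ! j)" for x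
  proof -
    have "x \<in> span Basis" using span_Basis by simp
    then obtain u where "x = (\<Sum>b\<in>Basis. of_rat (u b) * b)"
      using span_finite[OF finite_Basis] by auto
    also have "\<dots> = (\<Sum>j<N. of_rat (u (bs ! j)) * bs ! j)"
      by (rule sum.reindex_bij_betw[symmetric]) (simp add: N_def bij_betw_nth bs)
    finally show ?thesis by (rule exI[of _ "\<lambda>j. u (bs ! j)"])
  qed
  have "\<exists>A c. A \<in> carrier_mat N N \<and> c > 0 \<and> eigenvalue (map_mat of_int A) (of_int c * y)" for y :: 'a
  proof -
    define u where "u i = (SOME u. y * bs ! i = (\<Sum>j<N. of_rat (u j) * bs ! j))" for i
    have u: "y * bs ! i = (\<Sum>j<N. of_rat (u i j) * bs ! j)" for i
      unfolding u_def by (rule someI_ex[OF span])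
    \<comment> \<open>A common denominator of all coordinates \<open>u i j\<close> with
      \<open>i, j < N\<close>.\<close>
    define c where "c = (\<Prod>i<N. \<Prod>j<N. snd (quotient_of (u i j)))"
    have c0: "c > 0"
      unfolding c_def by (intro prod_pos ballI) (rule quotient_of_denom_pos')
    \<comment> \<open>The floor only turns an integral rational into an integer; nothing is rounded
      off for indices below \<open>N\<close>.\<close>
    define a where "a i j = \<lfloor>of_int c * u i j\<rfloor>" for i j
    have a: "of_int c * u i j = of_int (a i j)" if "i < N" "j < N" for i j
    proof -
      have "snd (quotient_of (u i j)) dvd (\<Prod>j<N. snd (quotient_of (u i j)))"
        using that by (intro dvd_prodI) auto
      also have "\<dots> dvd c"
        unfolding c_def using that by (intro dvd_prodI[of _ _ "\<lambda>i. \<Prod>j<N. snd (quotient_of (u i j))"]) auto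
      finally obtain k where k: "c = snd (quotient_of (u i j)) * k" by auto
      have "u i j = of_int (fst (quotient_of (u i j))) / of_int (snd (quotient_of (u i j)))"
        by (intro quotient_of_div) simp
      moreover have "snd (quotient_of (u i j)) > 0" by (rule quotient_of_denom_pos')
      ultimately have "of_int c * u i j = of_int (fst (quotient_of (u i j)) * k)"
        unfolding k by (simp add: field_simps)
      then show ?thesis by (simp only: a_def floor_of_int)
    qed
    define A where "A = mat N N (\<lambda>(i, j). a i j)"
    define v where "v = vec N (\<lambda>i. bs ! i)"
    have "map_mat of_int A *\<^sub>v v = (of_int c * y) \<cdot>\<^sub>v v"
    proof (rule eq_vecI)
      fix i assume "i < dim_vec ((of_int c * y) \<cdot>\<^sub>v v)"
      then have i: "i < N" by (simp add: v_def)
      have "(map_mat of_int A *\<^sub>v v) $ i = (\<Sum>j<N. of_int (a i j) * bs ! j)"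
        using i by (simp add: A_def v_def scalar_prod_def atLeast0LessThan)
      also have "\<dots> = (\<Sum>j<N. of_int c * (of_rat (u i j) * bs ! j))"
      proof (rule sum.cong[OF refl])
        fix j assume "j \<in> {..<N}"
        then have "of_int (a i j) = (of_rat (of_int c * u i j) :: 'a)"
          using a[OF i, of j] by simp
        then show "of_int (a i j) * bs ! j = of_int c * (of_rat (u i j) * bs ! j)"
          by (simp add: of_rat_mult)
      qed
      also have "\<dots> = of_int c * y * bs ! i"
        using u[of i] by (simp add: sum_distrib_left mult.assoc)
      finally show "(map_mat of_int A *\<^sub>v v) $ i = ((of_int c * y) \<cdot>\<^sub>v v) $ i"
        using i by (simp add: v_def)
    qed (simp add: A_def v_def)
    moreover have "v \<noteq> 0\<^sub>v N"
    proof
      assume v0: "v = 0\<^sub>v N"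
      show False
        using arg_cong[OF v0, of "\<lambda>w :: _ vec. w $ 0"] bs_nz[OF \<open>N > 0\<close>] \<open>N > 0\<close>
        by (simp add: v_def)
    qed
    ultimately have "eigenvalue (map_mat of_int A) (of_int c * y)"
      unfolding eigenvalue_def eigenvector_def by (intro exI[of _ v]) (auto simp: A_def v_def)
    then show ?thesis using c0 by (intro exI[of _ A] exI[of _ c]) (auto simp: A_def)
  qed
  then show ?thesis by (rule that)
qed

text \<open>
  If \<open>c\<close> clears the denominators of \<open>\<beta>\<close>, then \<open>c \<gamma>\<close> is an algebraic integer whose conjugates
  are bounded independently of \<open>n\<close>: its power \<open>(c \<gamma>)^(n m) = c^((n - 1) m) (c \<beta>)^m\<close> is an
  eigenvalue of an integer matrix with small row sums.
\<close>

lemma finite_roots_up_to_unity: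
  fixes \<beta> :: "'a::field_char_0"
  assumes "number_field TYPE('a)"
  shows "finite {\<gamma>. \<exists>n>0. \<exists>m>0. \<gamma> ^ (n * m) = \<beta> ^ m}"
proof -
  obtain N where N: "\<And>y :: 'a. \<exists>A c. A \<in> carrier_mat N N \<and> c > 0 \<and>
      eigenvalue (map_mat of_int A) (of_int c * y)"
    using number_field_int_matrix[OF assms] by blast
  obtain A c where A: "A \<in> carrier_mat N N" and c: "c > 0"
    and ev: "eigenvalue (map_mat of_int A) (of_int c * \<beta>)"
    using N by blast
  obtain r0 where r0: "row_sums_le A r0" "r0 \<ge> 0"
    by (rule row_sums_le_exists)
  \<comment> \<open>Dominates both the scalar \<open>c\<close> and the row sums of \<open>A\<close>,
    so a product of \<open>k\<close> such factors is bounded by \<open>r ^ k\<close>.\<close>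
  define r where "r = max c r0"
  let ?S = "{\<gamma>. \<exists>n>0. \<exists>m>0. \<gamma> ^ (n * m) = \<beta> ^ m}"
  have "finite ((\<lambda>\<gamma>. of_int c * \<gamma>) ` ?S)"
  proof (rule finite_integral_bounded[where N = N and r = "of_int r"])
    fix x assume "x \<in> (\<lambda>\<gamma>. of_int c * \<gamma>) ` ?S"
    obtain B d where B: "B \<in> carrier_mat N N" "d > 0" "eigenvalue (map_mat of_int B) (of_int d * x)"
      using N by blast
    \<comment> \<open>\<open>char_poly B\<close> kills \<open>d * x\<close>; substituting
      \<open>d * X\<close> gives a polynomial, not necessarily monic, that kills \<open>x\<close>
      and still has degree at most \<open>N\<close>.\<close>
    let ?g = "pcompose (char_poly B) [:0, d:]"
    have dm: "degree (char_poly B) = N" "lead_coeff (char_poly B) = 1"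
      using degree_monic_char_poly[OF B(1)] by auto
    have "?g \<noteq> 0"
      using B(2) dm by (auto simp: pcompose_eq_0_iff)
    moreover have "degree ?g \<le> N"
      using dm B(2) by (simp add: degree_pcompose)
    moreover have "map_poly of_int [:0, d:] = [:0, of_int d :: 'a:]"
      by (intro poly_eqI) (simp add: coeff_map_poly coeff_pCons split: nat.split)
    then have "poly (map_poly of_int ?g) x = poly (map_poly of_int (char_poly B)) (of_int d * x)"
      by (simp add: of_int_hom.map_poly_pcompose poly_pcompose mult.commute)
    then have "poly (map_poly of_int ?g) x = 0"
      using iffD1[OF eigenvalue_of_int_root[OF B(1)] B(3)] by (simp only:)
    ultimately show "\<exists>g :: int poly. g \<noteq> 0 \<and> degree g \<le> N \<and> poly (map_poly of_int g) x = 0"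
      by blast
  next
    fix x assume "x \<in> (\<lambda>\<gamma>. of_int c * \<gamma>) ` ?S"
    then obtain \<gamma> where x: "x = of_int c * \<gamma>" and "\<gamma> \<in> ?S"
      by (rule imageE)
    then obtain n m where nm: "n > 0" "m > 0" and \<gamma>: "\<gamma> ^ (n * m) = \<beta> ^ m"
      by blast
    define k where "k = n * m"
    have k: "k > 0" "k = (n - 1) * m + m"
      using nm by (simp_all add: k_def mult_eq_if)
    define B where "B = c ^ ((n - 1) * m) \<cdot>\<^sub>m (A ^\<^sub>m m)"
    have B: "B \<in> carrier_mat N N" using A by (simp add: B_def)
    have mapB: "map_mat of_int B = of_int (c ^ ((n - 1) * m)) \<cdot>\<^sub>m (map_mat of_int A ^\<^sub>m m :: 'b::field_char_0 mat)"
      unfolding B_def of_int_hom.mat_hom_pow[OF A, symmetric] using A by (intro eq_matI) auto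
    \<comment> \<open>Of the \<open>k\<close> factors \<open>c\<close>, exactly \<open>m\<close> are
      paired with the factors \<beta>; the other \<open>(n - 1) * m\<close> stay as an integer
      scalar.\<close>
    have "x ^ k = of_int (c ^ ((n - 1) * m)) * (of_int c * \<beta>) ^ m"
      unfolding x power_mult_distrib k(2) power_add using \<gamma> k_def k(2)
      by (simp add: power_mult_distrib flip: power_add)
    then have "eigenvalue (map_mat of_int B) (x ^ k)"
      unfolding mapB using A ev
      by (auto intro!: eigenvalue_smult_mat[of _ N] eigenvalue_pow_mat[of _ N])
    then have rootx: "poly (map_poly of_int (char_poly B)) (x ^ k) = 0"
      using eigenvalue_of_int_root[OF B] by blast
    define F where "F = pcompose (char_poly B) (Polynomial.monom 1 k)"
    \<comment> \<open>Stated for an arbitrary field of characteristic \<open>0\<close> because it is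
      used both at \<open>x\<close> and at the complex roots of \<open>F\<close>.\<close>
    have evalF: "poly (map_poly of_int F) z = poly (map_poly of_int (char_poly B)) (z ^ k)"
      for z :: "'b::field_char_0"
      by (simp add: F_def of_int_hom.map_poly_pcompose poly_pcompose poly_monom map_poly_monom)
    have "lead_coeff F = 1"
      unfolding F_def using degree_monic_char_poly[OF B] k(1)
      by (subst lead_coeff_comp) (auto simp: degree_monom_eq)
    moreover have "cmod z \<le> of_int r" if "poly (map_poly of_int F) z = 0" for z
    proof -
      have "row_sums_le B (r ^ k)"
        unfolding row_sums_le_def
      proof (intro allI impI)
        fix i assume i: "i < dim_row B"
        have "(\<Sum>j<dim_col B. \<bar>B $$ (i, j)\<bar>) = c ^ ((n - 1) * m) * (\<Sum>j<N. \<bar>(A ^\<^sub>m m) $$ (i, j)\<bar>)"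
          using i A c by (auto simp: B_def abs_mult sum_distrib_left intro!: sum.cong)
        also have "\<dots> \<le> r ^ ((n - 1) * m) * r0 ^ m"
          using row_sums_le_pow[OF A r0, of m] i B c r0
          unfolding row_sums_le_def carrier_matD[OF pow_carrier_mat[OF A]]
          by (intro mult_mono power_mono) (auto simp: r_def sum_nonneg)
        also have "\<dots> \<le> r ^ ((n - 1) * m) * r ^ m"
          using c r0 by (intro mult_left_mono power_mono) (auto simp: r_def)
        finally show "(\<Sum>j<dim_col B. \<bar>B $$ (i, j)\<bar>) \<le> r ^ k"
          by (simp add: k(2) power_add)
      qed
      moreover have "eigenvalue (map_mat of_int B) (z ^ k)"
        using that evalF eigenvalue_of_int_root[OF B] by metis
      \<comment> \<open>Taking \<open>k\<close>-th roots leaves the bound \<open>r\<close>, in which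
        neither \<open>n\<close> nor \<open>m\<close> occurs.\<close>
      ultimately have "cmod (z ^ k) \<le> of_int (r ^ k)"
        using eigenvalue_le_row_sums[OF B] by blast
      then have "cmod z ^ k \<le> of_int r ^ k" by (simp add: norm_power)
      then show ?thesis
        using k(1) c by (auto intro: power_le_imp_le_base simp: r_def power_mono_iff)
    qed
    moreover have "poly (map_poly of_int F) x = 0"
      using rootx by (simp only: evalF)
    ultimately show "\<exists>F :: int poly. lead_coeff F = 1 \<and> poly (map_poly of_int F) x = 0 \<and>
        (\<forall>z. poly (map_poly of_int F) z = 0 \<longrightarrow> cmod z \<le> of_int r)"
      by blast
  qed
  moreover have "inj_on (\<lambda>\<gamma>. of_int c * \<gamma>) ?S"
    using c by (auto intro!: inj_onI)
  ultimately show ?thesis by (rule finite_imageD)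
qed

section \<open>Bounding the exponents\<close>

text \<open>Choose one \<gamma> for each exponent. If two exponents shared the same \<gamma>, then
  \<gamma> and with it \<beta> would be a root of unity. So the choice is injective into a finite
  set.\<close>

lemma finite_root_exponents:
  fixes \<beta> :: "'a::field_char_0"
  assumes "number_field TYPE('a)" "\<beta> \<noteq> 0" "\<not> root_of_unity \<beta>"
  shows "finite {n. n > 0 \<and> (\<exists>\<gamma>. \<exists>m>0. \<gamma> ^ (n * m) = \<beta> ^ m)}" (is "finite ?T")
proof -
  have "\<forall>n\<in>?T. \<exists>\<gamma>. \<exists>m>0. \<gamma> ^ (n * m) = \<beta> ^ m" by blast
  then obtain g where g: "\<And>n. n \<in> ?T \<Longrightarrow> \<exists>m>0. g n ^ (n * m) = \<beta> ^ m"
    by (metis (no_types, lifting))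
  have "finite (g ` ?T)"
    by (rule finite_subset[OF _ finite_roots_up_to_unity[OF assms(1), of \<beta>]]) (use g in blast)
  moreover have "inj_on g ?T"
  proof -
    have False if lt: "n1 < n2" and T: "n1 \<in> ?T" "n2 \<in> ?T" and eq: "g n1 = g n2" for n1 n2
    proof -
      obtain m1 m2 where m: "m1 > 0" "g n1 ^ (n1 * m1) = \<beta> ^ m1" "m2 > 0" "g n1 ^ (n2 * m2) = \<beta> ^ m2"
        using g[OF T(1)] g[OF T(2)] eq by auto
      \<comment> \<open>Raising the relations to the powers \<open>m2\<close> and \<open>m1\<close>
        makes both right-hand sides equal to the \<open>?M\<close>-th power of \<beta>.\<close>
      let ?x = "g n1" and ?M = "m1 * m2"
      have nz: "?x \<noteq> 0"
      proof
        assume "?x = 0"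
        then have "\<beta> ^ m1 = 0" using m(1,2) T(1) by (simp add: power_0_left)
        then show False using assms(2) by simp
      qed
      have "?x ^ (n1 * ?M) = \<beta> ^ ?M"
        using arg_cong[OF m(2), of "\<lambda>y. y ^ m2"] by (simp add: power_mult[symmetric] mult.assoc)
      moreover have "?x ^ (n2 * ?M) = \<beta> ^ ?M"
        using arg_cong[OF m(4), of "\<lambda>y. y ^ m1"]
        by (simp add: power_mult[symmetric] mult.assoc mult.commute[of m1])
      moreover have "n2 * ?M = n1 * ?M + (n2 - n1) * ?M"
        using lt by (simp flip: add_mult_distrib)
      ultimately have "?x ^ (n1 * ?M) * ?x ^ ((n2 - n1) * ?M) = ?x ^ (n1 * ?M) * 1"
        by (simp only: power_add mult_1_right)
      then have one: "?x ^ ((n2 - n1) * ?M) = 1"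
        using nz by (simp only: mult_cancel_left power_eq_0_iff) blast
      \<comment> \<open>Some power of \<beta> is a power of \<open>?x\<close>, so \<beta> inherits
        being a root of unity.\<close>
      have "\<beta> ^ (m1 * ((n2 - n1) * ?M)) = (?x ^ (n1 * m1)) ^ ((n2 - n1) * ?M)"
        by (subst power_mult) (simp only: m(2))
      also have "\<dots> = (?x ^ ((n2 - n1) * ?M)) ^ (n1 * m1)"
        by (simp only: power_mult[symmetric] mult.commute[of "n1 * m1"])
      also have "\<dots> = 1" by (simp add: one)
      finally have "\<beta> ^ (m1 * ((n2 - n1) * ?M)) = 1" .
      moreover have "m1 * ((n2 - n1) * ?M) > 0" using m(1,3) lt by simp
      ultimately show False
        using assms(3) unfolding root_of_unity_def by blast
    qed
    then have sep: "g n1 \<noteq> g n2" if "n1 < n2" "n1 \<in> ?T" "n2 \<in> ?T" for n1 n2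
      using that by blast
    show ?thesis
    proof (rule inj_onI)
      fix n1 n2 assume "n1 \<in> ?T" "n2 \<in> ?T" "g n1 = g n2"
      then show "n1 = n2"
        using sep[of n1 n2] sep[of n2 n1] by (cases n1 n2 rule: linorder_cases) simp_all
    qed
  qed
  ultimately show ?thesis by (rule finite_imageD)
qed

subsection \<open>Counting orbits\<close>

lemma finite_binomial_roots:
  assumes "n \<ge> 1"
  shows "finite (binomial_roots n b)" and "card (binomial_roots n b) \<le> n"
proof -
  let ?p = "Polynomial.monom 1 n - [:to_ac b:]"
  have "coeff ?p n = 1"
    using assms by (cases n) auto
  then have "?p \<noteq> 0"
    by (metis coeff_0 zero_neq_one)
  moreover have "degree ?p \<le> n"
    by (intro degree_diff_le) (simp_all add: degree_monom_le)
  moreover have "binomial_roots n b = {z. poly ?p z = 0}"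
    by (simp add: binomial_roots_def poly_monom)
  ultimately show "finite (binomial_roots n b)" "card (binomial_roots n b) \<le> n"
    using poly_roots_finite[of ?p] poly_roots_degree[of ?p] by simp_all
qed

text \<open>The orbits partition the root set. The restricted form of the action gives access to the
  orbit counting of group actions.\<close>

lemma sum_card_galois_orbits:
  assumes "n \<ge> 1"
  shows "(\<Sum>Q\<in>galois_orbits n b. card Q) \<le> n"
proof -
  interpret group_action absolute_galois_group "binomial_roots n b"
    "\<lambda>\<sigma>. restrict \<sigma> (binomial_roots n b)"
    by (rule group_action_binomial_roots)
  have "(\<Sum>Q\<in>galois_orbits n b. card Q) = card (binomial_roots n b)"
    using disjoint_sum[OF finite_binomial_roots(1)[OF assms], of "\<lambda>_. 1 :: nat"]
    by (simp add: galois_orbits_conv_restrict)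
  then show ?thesis using finite_binomial_roots(2)[OF assms, of b] by simp
qed

lemma absolute_galois_group_prod:
  assumes "\<sigma> \<in> carrier absolute_galois_group"
  shows "\<sigma> (prod f A) = (\<Prod>x\<in>A. \<sigma> (f x))"
proof -
  have "\<sigma> 1 = 1"
    using absolute_galois_group_power[OF assms, of undefined 0] by simp
  moreover have "\<sigma> (x * y) = \<sigma> x * \<sigma> y" for x y
    using assms by (simp add: absolute_galois_group_def)
  ultimately show ?thesis
    by (induction A rule: infinite_finite_induct) simp_all
qed

text \<open>An automorphism maps the finite orbit injectively into itself, hence permutes it; this
  makes the product of the orbit invariant.\<close>

lemma galois_orbit_image:
  assumes "n \<ge> 1" "Q \<in> galois_orbits n b" "\<sigma> \<in> carrier absolute_galois_group"
  shows "\<sigma> ` Q = Q" and "inj_on \<sigma> Q"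
proof -
  have inj: "inj \<sigma>"
    using assms(3) by (simp add: absolute_galois_group_def bij_is_inj)
  then show "inj_on \<sigma> Q" by (rule inj_on_subset) simp
  obtain z where z: "z \<in> binomial_roots n b" "Q = {\<tau> z |\<tau>. \<tau> \<in> carrier absolute_galois_group}"
    using assms(2) unfolding galois_orbits_def orbits_def orbit_def by auto
  have "Q \<subseteq> binomial_roots n b"
    using z absolute_galois_group_binomial_roots_iff by auto
  then have "finite Q"
    using finite_binomial_roots(1)[OF assms(1)] by (rule finite_subset)
  moreover have "\<sigma> ` Q \<subseteq> Q"
  proof (rule image_subsetI)
    fix u assume "u \<in> Q"
    then obtain \<tau> where \<tau>: "\<tau> \<in> carrier absolute_galois_group" "u = \<tau> z"
      unfolding z(2) by auto
    have "\<sigma> \<circ> \<tau> \<in> carrier absolute_galois_group"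
      using \<tau> assms(3) by (simp add: absolute_galois_group_def bij_comp)
    then show "\<sigma> u \<in> Q"
      unfolding z(2) by (intro CollectI exI[of _ "\<sigma> \<circ> \<tau>"]) (simp add: \<tau>)
  qed
  ultimately show "\<sigma> ` Q = Q"
    using \<open>inj_on \<sigma> Q\<close> by (rule endo_inj_surj)
qed

text \<open>With \<open>d\<close> the orbit size and \<open>g = gcd d n\<close>, the witnesses are
  \<open>k = n div g\<close> and \<open>m = g\<close>. A small orbit thus forces a large
  \<open>k\<close>.\<close>

lemma galois_orbit_card:
  fixes \<beta> :: "'a::field_char_0"
  assumes n: "n \<ge> 1" and Q: "Q \<in> galois_orbits n \<beta>" and "\<beta> \<noteq> 0"
  obtains k m \<gamma> where "k > 0" "m > 0" "\<gamma> ^ (k * m) = \<beta> ^ m" "n \<le> k * card Q"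
proof -
  obtain z where z: "z \<in> binomial_roots n \<beta>" "Q = {\<tau> z |\<tau>. \<tau> \<in> carrier absolute_galois_group}"
    using Q unfolding galois_orbits_def orbits_def orbit_def by auto
  have sub: "Q \<subseteq> binomial_roots n \<beta>"
    using z absolute_galois_group_binomial_roots_iff by auto
  then have "finite Q"
    using finite_binomial_roots(1)[OF n] by (rule finite_subset)
  have "id \<in> carrier absolute_galois_group"
    by (simp add: absolute_galois_group_def)
  then have "z \<in> Q" unfolding z(2) by (intro CollectI exI[of _ id]) simp
  define d where "d = card Q"
  have "d > 0" using \<open>finite Q\<close> \<open>z \<in> Q\<close> unfolding d_def by (auto simp: card_gt_0_iff)
  have "\<Prod>Q \<in> range to_ac"
  proof (rule absolute_galois_group_fixed)
    fix \<sigma> :: "'a alg_closure \<Rightarrow> 'a alg_closure"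
    assume \<sigma>: "\<sigma> \<in> carrier absolute_galois_group"
    have "\<sigma> (\<Prod>Q) = prod id (\<sigma> ` Q)"
      using absolute_galois_group_prod[OF \<sigma>, of "\<lambda>x. x" Q] galois_orbit_image(2)[OF n Q \<sigma>]
      by (simp add: prod.reindex)
    then show "\<sigma> (\<Prod>Q) = \<Prod>Q"
      using galois_orbit_image(1)[OF n Q \<sigma>] by (simp add: id_def)
  qed
  then obtain w where w: "\<Prod>Q = to_ac w" by (rule rangeE)
  have "(\<Prod>Q) ^ n = (\<Prod>x\<in>Q. x ^ n)"
    by (rule prod_power_distrib)
  also have "\<dots> = (\<Prod>x\<in>Q. to_ac \<beta>)"
    using sub by (intro prod.cong) (auto simp: binomial_roots_def)
  finally have "to_ac (w ^ n) = to_ac (\<beta> ^ d)"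
    by (simp add: w d_def)
  then have wn: "w ^ n = \<beta> ^ d"
    by (simp only: to_ac_eq_iff)
  define g where "g = gcd d n"
  \<comment> \<open>Bezout over the naturals: the negative coefficient moves to the other side and
    reappears as division by a power of \<beta>.\<close>
  obtain x y where xy: "d * x = n * y + g"
    using bezout_nat[of d n] \<open>d > 0\<close> unfolding g_def by blast
  define k where "k = n div g"
  have kg: "k * g = n" by (simp add: k_def g_def)
  have "g > 0" using n by (simp add: g_def)
  have "k > 0" using kg n by (cases k) auto
  have "g \<le> d" using \<open>d > 0\<close> by (simp add: g_def)
  \<comment> \<open>This quotient is \<gamma>: its \<open>n\<close>-th power is \<beta> to the
    exponent \<open>d * x - n * y = g\<close>.\<close>
  have "(w ^ x / \<beta> ^ y) ^ (k * g) = (w ^ n) ^ x / \<beta> ^ (n * y)"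
    unfolding kg power_divide by (metis mult.commute power_mult)
  also have "(w ^ n) ^ x = \<beta> ^ (n * y) * \<beta> ^ g"
    by (simp only: wn xy flip: power_mult power_add)
  finally have "(w ^ x / \<beta> ^ y) ^ (k * g) = \<beta> ^ g"
    using assms(3) by simp
  moreover have "n \<le> k * card Q"
    using mult_le_mono2[OF \<open>g \<le> d\<close>, of k] kg by (simp add: d_def)
  ultimately show ?thesis
    using \<open>k > 0\<close> \<open>g > 0\<close> by (intro that)
qed

theorem theorem1p3:
  fixes \<beta> :: "'a::field_char_0"
  assumes "number_field TYPE('a)"
    and "\<beta> \<noteq> 0"
    and "\<not> root_of_unity \<beta>"
  shows "\<exists>B::nat. \<forall>n\<ge>1. card (galois_orbits n \<beta>) \<le> B"
proof -
  obtain B where B: "\<And>k m \<gamma>. k > 0 \<Longrightarrow> m > 0 \<Longrightarrow> \<gamma> ^ (k * m) = \<beta> ^ m \<Longrightarrow> k \<le> B"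
    using finite_root_exponents[OF assms] unfolding finite_nat_set_iff_bounded_le by blast
  have "card (galois_orbits n \<beta>) \<le> B" if n: "n \<ge> 1" for n
  proof -
    have "n \<le> B * card Q" if Q: "Q \<in> galois_orbits n \<beta>" for Q
    proof -
      obtain k m \<gamma> where k: "k > 0" "m > 0" "\<gamma> ^ (k * m) = \<beta> ^ m" "n \<le> k * card Q"
        by (rule galois_orbit_card[OF n Q assms(2)])
      show ?thesis
        using mult_le_mono1[OF B[OF k(1-3)], of "card Q"] by (rule order.trans[OF k(4)])
    qed
    \<comment> \<open>Double counting: the number of orbits times \<open>n\<close> is at most
      \<open>B\<close> times the number of roots, hence at most \<open>B * n\<close>, and the
      positive \<open>n\<close> cancels.\<close>
    then have "(\<Sum>Q\<in>galois_orbits n \<beta>. n) \<le> (\<Sum>Q\<in>galois_orbits n \<beta>. B * card Q)"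
      by (rule sum_mono)
    also have "\<dots> = B * (\<Sum>Q\<in>galois_orbits n \<beta>. card Q)"
      by (simp add: sum_distrib_left)
    also have "\<dots> \<le> B * n"
      by (intro mult_le_mono2 sum_card_galois_orbits n)
    finally show ?thesis using n by simp
  qed
  then show ?thesis by blast
qed

end
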